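(* For every infinite step size sequence $(\gamma_t)_{t\in\mathbb{N}}$ with $\gamma_t>0$, infinite horizon SGD with step sizes $\gamma_t$, on objectives that are Lipschitz, strongly convex, and defined over a closed convex set of bounded diameter, is either bad in expectation or bad almost surely (that is, at least one of the two properties holds).
   Context: An admissible problem consists of: a closed convex set $\mathcal{W}\subset\mathbb{R}^d$ with $\mathrm{diam}(\mathcal{W})\le D$; a convex objective $F$ with minimizer $x^*\in\mathcal{W}$ which is $\lambda$-strongly convex over $\mathcal{W}$, i.e. $F(y)\ge F(x)+\langle g,y-x\rangle+\frac{\lambda}{2}\|y-x\|^2$ for all $x,y\in\mathcal{W}$, $g\in\partial F(x)$; and a stochastic subgradient oracle: random maps $\hat g_t$, $t\in\mathbb{N}$, independent across $t$, with $\mathbb{E}[\hat g_t(x)]=g_t(x)\in\partial F(x)$ for all $x\in\mathcal{W}$; such that $\|g\|\le G$ for all $x\in\mathcal{W}$, $g\in\partial F(x)$ and $\|\hat g_t(x)\|\le G$ almost surely for all $x\in\mathcal{W}$ (for some constants $G,D,\lambda>0$). SGD with infinite horizon step sizes $\gamma_t$: starting from $x_1\in\mathcal{W}$, $x_{t+1}=\Pi_{\mathcal{W}}(x_t-\gamma_t\hat g_t(x_t))$ for all $t\in\mathbb{N}$, with $\Pi_{\mathcal{W}}$ the Euclidean projection onto $\mathcal{W}$. The sequence $(\gamma_t)$ is deterministic and does not depend on a final time. The sequence $\gamma_t$ is bad in expectation if for some admissible problem (objective and subgradient oracle) with SGD iterates $(x_t)_{t\in\mathbb{N}}$, there is a fixed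 (deterministic) subsequence of times $\{t_k\}_{k\in\mathbb{N}}$ such that $\lim_{k\to\infty}t_k\,\mathbb{E}[F(x_{t_k})-F(x^* )]=\infty$. The sequence $\gamma_t$ is bad almost surely if for some admissible problem with SGD iterates $(x_t)_{t\in\mathbb{N}}$, with probability $1$ there exists a random infinite sequence of times $\{t_k\}$ such that $\lim_{k\to\infty}t_k[F(x_{t_k})-F(x^* )]=\infty$. *)

theory Defs
  imports "HOL-Probability.Probability"
begin

definition subdifferential :: "('a::euclidean_space \<Rightarrow> real) \<Rightarrow> 'a \<Rightarrow> 'a set" where
  "subdifferential F x = {g. \<forall>y. F y \<ge> F x + g \<bullet> (y - x)}"

text \<open>
  Independence of random maps on \<open>W\<close>: the maps are jointly measurable with respect to
  independent sub-\<open>\<sigma>\<close>-algebras \<open>A t\<close> (for maps of the form \<open>h t (\<xi> t \<omega>) x\<close> with independent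
  seeds \<open>\<xi> t\<close>, take \<open>A t\<close> to be generated by \<open>\<xi> t\<close>). Independence of the evaluations
  at each fixed point alone would say nothing about the value at a random point such as an iterate.
\<close>
definition indep_random_maps ::
    "'w measure \<Rightarrow> 'a::euclidean_space set \<Rightarrow> nat set \<Rightarrow> (nat \<Rightarrow> 'w \<Rightarrow> 'a \<Rightarrow> 'a) \<Rightarrow> bool" where
  "indep_random_maps M W T h \<longleftrightarrow>
     (\<exists>A :: nat \<Rightarrow> 'w measure.
        (\<forall>t\<in>T. subalgebra M (A t)) \<and>
        prob_space.indep_sets M (\<lambda>t. sets (A t)) T \<and>
        (\<forall>t\<in>T. (\<lambda>(\<omega>, x). h t \<omega> x) \<in> A t \<Otimes>\<^sub>M restrict_space borel W \<rightarrow>\<^sub>M borel))"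

text \<open>
  Times are the positive naturals; values at time 0 are never used. The objective is finite and
  convex on the whole space and its subgradients are global ones: subgradients relative to \<open>W\<close>
  would be unbounded at boundary points of \<open>W\<close>.
\<close>
locale admissible_problem = prob_space M
  for M :: "'w measure" +
  fixes W :: "'a::euclidean_space set"
    and F :: "'a \<Rightarrow> real"
    and xmin :: 'a
    and ghat :: "nat \<Rightarrow> 'w \<Rightarrow> 'a \<Rightarrow> 'a"
    and G D lam :: real
  assumes constants_pos: "G > 0" "D > 0" "lam > 0"
    and closed_W: "closed W"
    and convex_W: "convex W"
    and bounded_W: "bounded W"
    and diameter_W: "diameter W \<le> D"
    and convex_F: "convex_on UNIV F"
    and minimizer: "is_arg_min F (\<lambda>x. x \<in> W) xmin"
    and strongly_convex:
      "\<And>x y g. x \<in> W \<Longrightarrow> y \<in> W \<Longrightarrow> g \<in> subdifferential F x \<Longrightarrow>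
         F y \<ge> F x + g \<bullet> (y - x) + lam / 2 * (norm (y - x))\<^sup>2"
    and subgradient_bound:
      "\<And>x g. x \<in> W \<Longrightarrow> g \<in> subdifferential F x \<Longrightarrow> norm g \<le> G"
    and oracle_indep: "indep_random_maps M W {1..} ghat"
    and oracle_integrable:
      "\<And>t x. t \<ge> 1 \<Longrightarrow> x \<in> W \<Longrightarrow> integrable M (\<lambda>\<omega>. ghat t \<omega> x)"
    and oracle_unbiased:
      "\<And>t x. t \<ge> 1 \<Longrightarrow> x \<in> W \<Longrightarrow> expectation (\<lambda>\<omega>. ghat t \<omega> x) \<in> subdifferential F x"
    and oracle_bound:
      "\<And>t x. t \<ge> 1 \<Longrightarrow> x \<in> W \<Longrightarrow> AE \<omega> in M. norm (ghat t \<omega> x) \<le> G"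

fun sgd ::
    "'a::euclidean_space set \<Rightarrow> (nat \<Rightarrow> real) \<Rightarrow> (nat \<Rightarrow> 'w \<Rightarrow> 'a \<Rightarrow> 'a) \<Rightarrow> 'a \<Rightarrow> nat \<Rightarrow> 'w \<Rightarrow> 'a" where
  "sgd W \<gamma> ghat x1 0 \<omega> = x1"
| "sgd W \<gamma> ghat x1 (Suc 0) \<omega> = x1"
| "sgd W \<gamma> ghat x1 (Suc (Suc n)) \<omega> =
     (let t = Suc n; x = sgd W \<gamma> ghat x1 t \<omega>
      in closest_point W (x - \<gamma> t *\<^sub>R ghat t \<omega> x))"

text \<open>
  The type \<open>'a\<close> is the ambient space \<open>\<real>\<^sup>d\<close>. Since one cannot quantify existentially over types,
  the type of outcomes is fixed to \<open>nat \<Rightarrow> real\<close>, with an arbitrary \<open>\<sigma>\<close>-algebra and probability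
  measure; it is large enough to carry an independent sequence of real seeds with any laws.
\<close>
definition bad_in_expectation :: "'a::euclidean_space itself \<Rightarrow> (nat \<Rightarrow> real) \<Rightarrow> bool" where
  "bad_in_expectation _ \<gamma> \<longleftrightarrow>
     (\<exists>(M :: (nat \<Rightarrow> real) measure) (W :: 'a set) F xmin ghat G D lam.
        admissible_problem M W F xmin ghat G D lam \<and>
        (\<exists>x1\<in>W. \<exists>\<tau> :: nat \<Rightarrow> nat. strict_mono \<tau> \<and> (\<forall>k. \<tau> k \<ge> 1) \<and>
           filterlim
             (\<lambda>k. real (\<tau> k) *
                prob_space.expectation M (\<lambda>\<omega>. F (sgd W \<gamma> ghat x1 (\<tau> k) \<omega>) - F xmin))
             at_top sequentially))"

definition bad_almost_surely :: "'a::euclidean_space itself \<Rightarrow> (nat \<Rightarrow> real) \<Rightarrow> bool" where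
  "bad_almost_surely _ \<gamma> \<longleftrightarrow>
     (\<exists>(M :: (nat \<Rightarrow> real) measure) (W :: 'a set) F xmin ghat G D lam.
        admissible_problem M W F xmin ghat G D lam \<and>
        (\<exists>x1\<in>W. AE \<omega> in M. \<exists>\<tau> :: nat \<Rightarrow> nat. strict_mono \<tau> \<and> (\<forall>k. \<tau> k \<ge> 1) \<and>
           filterlim
             (\<lambda>k. real (\<tau> k) * (F (sgd W \<gamma> ghat x1 (\<tau> k) \<omega>) - F xmin))
             at_top sequentially))"

end

theory Submission
  imports Defs
begin

text \<open>
  Every positive step size sequence is already bad in expectation, and deterministic oracles on the closed
  unit ball are enough to show this. Which objective does the harm depends on whether
  \<open>t * \<gamma> t\<close> is bounded.

  If \<open>t * \<gamma> t\<close> is unbounded, the steps are too long for an objective with a kink. The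
  function \<open>norm x + (norm x)\<^sup>2 / 2\<close> has an oracle whose answers have norm at least 1, even
  at the minimizer. Hence step \<open>t\<close>, unless it ends on the boundary of the ball, has length at
  least \<open>\<gamma> t\<close>, and one of \<open>x t\<close>, \<open>x (t + 1)\<close> is at distance at least
  \<open>\<gamma> t / 2\<close> from the minimizer. Read backwards: an error of order \<open>1/t\<close> along the
  whole trajectory forces \<open>\<gamma> t\<close> to be of order \<open>1/t\<close> (lemma
  \<open>bounded_error_imp_steps_bounded\<close>).

  If \<open>t * \<gamma> t \<le> C\<close> for all \<open>t\<close>, the steps are too short for an objective that is
  flat enough. For \<open>lam / 2 * (norm x)\<^sup>2\<close> the recursion is
  \<open>x (t + 1) = (1 - lam * \<gamma> t) * x t\<close>, so \<open>norm (x t)\<close> decays no faster than roughly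
  \<open>t\<close> to the power \<open>- lam * C\<close>. The strong convexity constant is part of the problem and
  may be adapted to \<open>C\<close>; with \<open>lam = 1 / (8 * C)\<close> the product of \<open>t\<close> and the error
  is at least of order \<open>sqrt t\<close> (lemma \<open>bounded_steps_imp_quadratic_unbounded\<close>).

  Both objectives belong to the family \<open>c * norm x + lam / 2 * (norm x)\<^sup>2\<close>, with
  \<open>c = 1\<close> and \<open>c = 0\<close>, whose admissibility is checked once (lemma
  \<open>admissible_radial\<close>).
\<close>

section \<open>Unbounded rescaled errors\<close>

lemma unbounded_nonneg_subseq_at_top:
  fixes X :: "nat \<Rightarrow> real"
  assumes unbounded: "\<not> Bseq X" and nonneg: "\<And>n. X n \<ge> 0"
  shows "\<exists>\<tau> :: nat \<Rightarrow> nat. strict_mono \<tau> \<and> (\<forall>k. \<tau> k \<ge> 1) \<and> filterlim (\<lambda>k. X (\<tau> k)) at_top sequentially"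
proof -
  have late: "\<exists>n>N. X n \<ge> K" for N and K :: real
  proof (rule ccontr)
    assume "\<not> ?thesis"
    then have "\<forall>n>N. norm (X n) \<le> K"
      using nonneg by fastforce
    then have "eventually (\<lambda>n. norm (X n) \<le> K) sequentially"
      by (intro eventually_mono[OF eventually_gt_at_top[of N]]) simp
    then show False
      using unbounded BfunI by blast
  qed
  obtain \<tau> where \<tau>: "\<And>k. \<tau> k \<ge> 1 \<and> X (\<tau> k) \<ge> real k" "\<And>k. \<tau> k < \<tau> (Suc k)"
  proof -
    have "\<exists>n. n \<ge> 1 \<and> X n \<ge> real 0"
      using nonneg by auto
    moreover have "\<exists>m. (m \<ge> 1 \<and> X m \<ge> real (Suc k)) \<and> n < m" for n k
      using late[of n "real (Suc k)"] by (metis gr_implies_not0 less_one not_le)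
    ultimately have "\<exists>\<tau>. \<forall>k. (\<tau> k \<ge> 1 \<and> X (\<tau> k) \<ge> real k) \<and> \<tau> k < \<tau> (Suc k)"
      using dependent_nat_choice[of "\<lambda>k n. n \<ge> 1 \<and> X n \<ge> real k" "\<lambda>_ n m. n < m"] by presburger
    then show thesis
      using that by blast
  qed
  have "filterlim (\<lambda>k. X (\<tau> k)) at_top sequentially"
    by (rule filterlim_at_top_mono[OF filterlim_real_sequentially]) (use \<tau> in auto)
  then show ?thesis
    using \<tau> by (auto intro!: exI[of _ \<tau>] simp: strict_mono_Suc_iff)
qed

lemma sgd_deterministic_oracle:
  fixes \<omega> :: 'v and \<omega>' :: 'w
  shows "sgd W \<gamma> (\<lambda>_ _. h) x1 t \<omega> = sgd W \<gamma> (\<lambda>_ _. h) x1 t \<omega>'"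
proof (induction t)
  case (Suc t)
  then show ?case
    by (cases t) (auto simp: Let_def)
qed simp

lemma sgd_in_domain:
  assumes "closed W" "x1 \<in> W"
  shows "sgd W \<gamma> ghat x1 t \<omega> \<in> W"
  using assms
  by (induction W \<gamma> ghat x1 t \<omega> rule: sgd.induct) (auto simp: Let_def intro!: closest_point_in_set)

lemma sgd_step:
  assumes "t \<ge> 1"
  shows "sgd W \<gamma> ghat x1 (Suc t) \<omega> =
    closest_point W (sgd W \<gamma> ghat x1 t \<omega> - \<gamma> t *\<^sub>R ghat t \<omega> (sgd W \<gamma> ghat x1 t \<omega>))"
  using assms by (cases t) (auto simp: Let_def)

text \<open>
  With a deterministic oracle the iterates do not depend on the outcome, so the expected error is
  the error of a single trajectory, and for the existence of bad times it suffices that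
  \<open>t\<close> times this error is unbounded.
\<close>

lemma bad_in_expectation_if_unbounded:
  fixes W :: "'a::euclidean_space set" and M :: "(nat \<Rightarrow> real) measure" and \<omega> :: 'w
  assumes adm: "admissible_problem M W F xmin (\<lambda>_ _. h) G D lam" and x1: "x1 \<in> W"
    and unbounded: "\<not> Bseq (\<lambda>t. real t * (F (sgd W \<gamma> (\<lambda>_ _. h) x1 t \<omega>) - F xmin))"
  shows "bad_in_expectation TYPE('a) \<gamma>"
proof -
  interpret admissible_problem M W F xmin "\<lambda>_ _. h" G D lam
    by (rule adm)
  define X where "X t = real t * (F (sgd W \<gamma> (\<lambda>_ _. h) x1 t \<omega>) - F xmin)" for t
  have "F xmin \<le> F x" if "x \<in> W" for x
    using minimizer that by (auto simp: is_arg_min_def not_less)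
  then have "X t \<ge> 0" for t
    unfolding X_def using sgd_in_domain[OF closed_W x1, of \<gamma> "\<lambda>_ _. h" t \<omega>]
    by (intro mult_nonneg_nonneg) simp_all
  moreover have "\<not> Bseq X"
    using unbounded unfolding X_def .
  ultimately obtain \<tau> :: "nat \<Rightarrow> nat" where
    \<tau>: "strict_mono \<tau>" "\<forall>k. \<tau> k \<ge> 1" "filterlim (\<lambda>k. X (\<tau> k)) at_top sequentially"
    using unbounded_nonneg_subseq_at_top by blast
  have "X t = real t * expectation (\<lambda>\<omega>. F (sgd W \<gamma> (\<lambda>_ _. h) x1 t \<omega>) - F xmin)" for t
  proof -
    have "(\<lambda>\<omega>' :: nat \<Rightarrow> real. F (sgd W \<gamma> (\<lambda>_ _. h) x1 t \<omega>') - F xmin)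
        = (\<lambda>_. F (sgd W \<gamma> (\<lambda>_ _. h) x1 t \<omega>) - F xmin)"
      by (intro ext arg_cong2[where f = minus] arg_cong[where f = F] sgd_deterministic_oracle refl)
    then show ?thesis
      unfolding X_def by (simp add: prob_space)
  qed
  then have "filterlim (\<lambda>k. real (\<tau> k) * expectation (\<lambda>\<omega>. F (sgd W \<gamma> (\<lambda>_ _. h) x1 (\<tau> k) \<omega>) - F xmin)) at_top sequentially"
    using \<tau>(3) by simp
  then show ?thesis
    unfolding bad_in_expectation_def using adm x1 \<tau>(1,2) by blast
qed

section \<open>A family of radial objectives\<close>

definition radial :: "real \<Rightarrow> real \<Rightarrow> 'a::euclidean_space \<Rightarrow> real" where
  "radial c lam x = c * norm x + lam / 2 * (norm x)\<^sup>2"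

text \<open>
  At the kink every vector of norm at most \<open>c\<close> is a subgradient. The choice \<open>c *\<^sub>R e\<close>
  with a unit vector \<open>e\<close>, rather than 0, makes an iterate leave the minimizer as soon as it
  reaches it.
\<close>

definition radial_subgradient :: "real \<Rightarrow> real \<Rightarrow> 'a \<Rightarrow> 'a::euclidean_space \<Rightarrow> 'a" where
  "radial_subgradient c lam e x = c *\<^sub>R (if x = 0 then e else sgn x) + lam *\<^sub>R x"

lemma radial_subgradient_in_subdifferential:
  assumes "c \<ge> 0" "lam \<ge> 0" "norm e = 1"
  shows "radial_subgradient c lam e x \<in> subdifferential (radial c lam) x"
proof -
  define s where "s = (if x = 0 then e else sgn x)"
  have s: "norm s = 1" "s \<bullet> x = norm x"
    using assms(3) by (auto simp: s_def norm_sgn sgn_div_norm dot_square_norm power2_eq_square)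
  have "radial c lam y \<ge> radial c lam x + radial_subgradient c lam e x \<bullet> (y - x)" for y
  proof -
    have "s \<bullet> y \<le> norm y"
      using norm_cauchy_schwarz[of s y] s by simp
    then have "c * (s \<bullet> y) \<le> c * norm y"
      using assms by (simp add: mult_left_mono)
    moreover have "lam / 2 * (norm y)\<^sup>2 = lam / 2 * (norm x)\<^sup>2 + lam * (x \<bullet> (y - x)) + lam / 2 * (norm (y - x))\<^sup>2"
      by (simp add: power2_norm_eq_inner algebra_simps inner_commute)
    moreover have "lam / 2 * (norm (y - x))\<^sup>2 \<ge> 0"
      using assms by simp
    ultimately show ?thesis
      using s by (simp add: radial_def radial_subgradient_def s_def[symmetric] algebra_simps)
  qed
  then show ?thesis
    by (simp add: subdifferential_def)
qed

lemma norm_radial_subgradient_ge: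
  assumes "c \<ge> 0" "lam \<ge> 0" "norm e = 1"
  shows "norm (radial_subgradient c lam e x) \<ge> c"
proof (cases "x = 0")
  case False
  then have "radial_subgradient c lam e x = (c + lam * norm x) *\<^sub>R sgn x"
    by (simp add: radial_subgradient_def sgn_div_norm algebra_simps)
  then show ?thesis
    using assms False by (simp add: norm_sgn)
qed (use assms in \<open>simp add: radial_subgradient_def\<close>)

lemma radial_convex_combination:
  assumes "c \<ge> 0" "0 \<le> \<theta>" "\<theta> \<le> 1"
  shows "radial c lam ((1 - \<theta>) *\<^sub>R x + \<theta> *\<^sub>R y)
    \<le> (1 - \<theta>) * radial c lam x + \<theta> * radial c lam y - lam / 2 * \<theta> * (1 - \<theta>) * (norm (y - x))\<^sup>2"
proof -
  have "norm ((1 - \<theta>) *\<^sub>R x + \<theta> *\<^sub>R y) \<le> (1 - \<theta>) * norm x + \<theta> * norm y"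
    using assms norm_triangle_ineq[of "(1 - \<theta>) *\<^sub>R x" "\<theta> *\<^sub>R y"] by simp
  then have "c * norm ((1 - \<theta>) *\<^sub>R x + \<theta> *\<^sub>R y) \<le> c * ((1 - \<theta>) * norm x + \<theta> * norm y)"
    using assms(1) by (rule mult_left_mono)
  moreover
  have "(norm ((1 - \<theta>) *\<^sub>R x + \<theta> *\<^sub>R y))\<^sup>2
      = (1 - \<theta>) * (norm x)\<^sup>2 + \<theta> * (norm y)\<^sup>2 - \<theta> * (1 - \<theta>) * (norm (y - x))\<^sup>2"
    by (simp add: power2_norm_eq_inner algebra_simps inner_commute)
  then have "lam / 2 * (norm ((1 - \<theta>) *\<^sub>R x + \<theta> *\<^sub>R y))\<^sup>2
      = lam / 2 * ((1 - \<theta>) * (norm x)\<^sup>2 + \<theta> * (norm y)\<^sup>2 - \<theta> * (1 - \<theta>) * (norm (y - x))\<^sup>2)"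
    by simp
  ultimately show ?thesis
    unfolding radial_def by argo
qed

text \<open>
  The inequality is needed for every subgradient, not just for the one that the oracle returns.
  The subgradient inequality at the point \<open>x + \<theta> *\<^sub>R (y - x)\<close>, combined with the
  strengthened convexity inequality and divided by \<open>\<theta>\<close>, gives the claim with
  \<open>lam\<close> replaced by \<open>(1 - \<theta>) * lam\<close>; then \<open>\<theta>\<close> tends to 0.
\<close>

lemma radial_strongly_convex:
  assumes "c \<ge> 0" and g: "g \<in> subdifferential (radial c lam) x"
  shows "radial c lam y \<ge> radial c lam x + g \<bullet> (y - x) + lam / 2 * (norm (y - x))\<^sup>2"
proof -
  have "s * (lam / 2 * (norm (y - x))\<^sup>2) \<le> radial c lam y - radial c lam x - g \<bullet> (y - x)"
    if "0 < s" "s < 1" for s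
  proof -
    define \<theta> where "\<theta> = 1 - s"
    have \<theta>: "0 < \<theta>" "\<theta> \<le> 1"
      using that by (auto simp: \<theta>_def)
    have "radial c lam x + g \<bullet> (((1 - \<theta>) *\<^sub>R x + \<theta> *\<^sub>R y) - x) \<le> radial c lam ((1 - \<theta>) *\<^sub>R x + \<theta> *\<^sub>R y)"
      using g by (simp add: subdifferential_def)
    moreover have "((1 - \<theta>) *\<^sub>R x + \<theta> *\<^sub>R y) - x = \<theta> *\<^sub>R (y - x)"
      by (simp add: algebra_simps)
    ultimately have "radial c lam x + \<theta> * (g \<bullet> (y - x))
        \<le> (1 - \<theta>) * radial c lam x + \<theta> * radial c lam y - lam / 2 * \<theta> * (1 - \<theta>) * (norm (y - x))\<^sup>2"
      using radial_convex_combination[of c \<theta> lam x y] assms(1) \<theta> by simp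
    then have "\<theta> * (s * (lam / 2 * (norm (y - x))\<^sup>2)) \<le> \<theta> * (radial c lam y - radial c lam x - g \<bullet> (y - x))"
      by (simp add: \<theta>_def algebra_simps)
    then show ?thesis
      using \<theta>(1) by (simp only: mult_le_cancel_left_pos)
  qed
  from field_le_mult_one_interval[OF this] show ?thesis
    by simp
qed

text \<open>
  A unit step in the direction of \<open>g\<close> raises the objective by at least \<open>norm g\<close> and stays
  in the ball of radius 2, where the objective is at most \<open>2 * c + 2 * lam\<close>.
\<close>

lemma radial_subgradient_bound:
  assumes "c \<ge> 0" "lam \<ge> 0" "norm x \<le> 1" and g: "g \<in> subdifferential (radial c lam) x"
  shows "norm g \<le> 2 * c + 2 * lam"
proof (cases "g = 0")
  case False
  define y where "y = x + sgn g"
  have y: "norm y \<le> 2"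
    using assms(3) False norm_triangle_ineq[of x "sgn g"] by (simp add: y_def norm_sgn)
  have "norm g = g \<bullet> (y - x)"
    using False by (simp add: y_def sgn_div_norm dot_square_norm power2_eq_square)
  also have "\<dots> \<le> radial c lam y - radial c lam x"
    using g by (simp add: subdifferential_def algebra_simps)
  also have "\<dots> \<le> radial c lam y"
  proof -
    have "radial c lam x \<ge> 0"
      unfolding radial_def using assms by (intro add_nonneg_nonneg mult_nonneg_nonneg) auto
    then show ?thesis
      by simp
  qed
  also have "\<dots> \<le> c * 2 + lam / 2 * 2\<^sup>2"
    unfolding radial_def using assms y by (intro add_mono mult_left_mono power_mono) auto
  finally show ?thesis
    by simp
qed (use assms in simp)

lemma admissible_radial:
  fixes e :: "'a::euclidean_space" and \<omega> :: 'w
  assumes c: "c \<ge> 0" and lam: "lam > 0" and e: "norm e = 1"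
  shows "admissible_problem (return (count_space UNIV) \<omega>) (cball 0 1) (radial c lam) 0
    (\<lambda>_ _. radial_subgradient c lam e) (2 * c + 2 * lam) 2 lam"
proof -
  let ?M = "return (count_space UNIV) \<omega>"
  let ?h = "radial_subgradient c lam e"
  interpret prob_space ?M
    by (rule prob_space_return) simp
  have h: "?h x \<in> subdifferential (radial c lam) x" for x
    using lam by (intro radial_subgradient_in_subdifferential c e) simp
  have [measurable]: "?h \<in> borel_measurable borel"
    unfolding radial_subgradient_def sgn_div_norm by measurable
  have "indep_sets (\<lambda>_. sets ?M) {1::nat..}"
  proof (rule indep_setsI)
    fix A :: "nat \<Rightarrow> 'w set" and J :: "nat set"
    assume "finite J"
    then have "indicator (\<Inter>j\<in>J. A j) \<omega> = (\<Prod>j\<in>J. indicator (A j) \<omega> :: real)"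
      by (induction J rule: finite_induct) (auto simp: indicator_def)
    then show "prob (\<Inter>j\<in>J. A j) = (\<Prod>j\<in>J. prob (A j))"
      by (simp add: measure_return)
  qed auto
  moreover have "(\<lambda>(\<omega>, x). ?h x) \<in> ?M \<Otimes>\<^sub>M restrict_space borel (cball 0 1) \<rightarrow>\<^sub>M borel"
    unfolding case_prod_beta
    by (rule measurable_compose[OF measurable_snd]) (simp add: measurable_restrict_space1)
  ultimately have indep: "indep_random_maps ?M (cball 0 1) {1..} (\<lambda>_ _. ?h)"
    unfolding indep_random_maps_def by (intro exI[of _ "\<lambda>_. ?M"]) (auto simp: subalgebra_def)
  show ?thesis
  proof
    show "convex_on UNIV (radial c lam :: 'a \<Rightarrow> real)"
    proof (rule convex_onI)
      fix \<theta> :: real and x y :: 'a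
      assume "0 < \<theta>" "\<theta> < 1"
      then have "lam / 2 * \<theta> * (1 - \<theta>) * (norm (y - x))\<^sup>2 \<ge> 0"
        using lam by simp
      then show "radial c lam ((1 - \<theta>) *\<^sub>R x + \<theta> *\<^sub>R y) \<le> (1 - \<theta>) * radial c lam x + \<theta> * radial c lam y"
        using radial_convex_combination[of c \<theta> lam x y] c \<open>0 < \<theta>\<close> \<open>\<theta> < 1\<close> by simp
    qed simp
    show "is_arg_min (radial c lam) (\<lambda>x. x \<in> cball 0 1) (0 :: 'a)"
      using c lam by (auto simp: is_arg_min_def radial_def not_less)
    show "AE \<omega>' in ?M. norm (?h x) \<le> 2 * c + 2 * lam" if "x \<in> cball 0 1" for x
      using radial_subgradient_bound[OF c _ _ h] lam that by simp
    show "radial c lam y \<ge> radial c lam x + g \<bullet> (y - x) + lam / 2 * (norm (y - x))\<^sup>2"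
      if "g \<in> subdifferential (radial c lam) x" for x y g :: 'a
      using radial_strongly_convex[OF c that] .
    show "expectation (\<lambda>_. ?h x) \<in> subdifferential (radial c lam) x" for x
      unfolding lebesgue_integral_const prob_space scaleR_one by (rule h)
  qed (use c lam indep in \<open>auto intro: radial_subgradient_bound\<close>)
qed

section \<open>The two regimes of step sizes\<close>

text \<open>
  An error of order \<open>1/t\<close> confines consecutive late iterates to distance \<open>K/t\<close> from the
  minimizer. Then the projection onto the ball is inactive, so the two iterates differ by a full
  step, whose length is at least \<open>\<gamma> t\<close> because of the kink.
\<close>

lemma bounded_error_imp_steps_bounded:
  fixes e :: "'a::euclidean_space"
  assumes lam: "lam \<ge> 0" and e: "norm e = 1" and x1: "norm x1 \<le> 1"
    and bounded: "Bseq (\<lambda>t. real t * radial 1 lam (sgd (cball 0 1) \<gamma> (\<lambda>_ _. radial_subgradient 1 lam e) x1 t \<omega>))"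
  shows "Bseq (\<lambda>t. real t * \<gamma> t)"
proof -
  define x where "x = (\<lambda>t. sgd (cball 0 1) \<gamma> (\<lambda>_ _. radial_subgradient 1 lam e) x1 t \<omega>)"
  define h where "h t = radial_subgradient 1 lam e (x t)" for t
  obtain K where K: "K > 0" "\<And>t. norm (real t * radial 1 lam (x t)) \<le> K"
    using bounded unfolding x_def by (auto elim: BseqE)
  have xK: "real t * norm (x t) \<le> K" for t
  proof -
    have "norm (x t) \<le> radial 1 lam (x t)"
      using lam by (simp add: radial_def)
    then have "real t * norm (x t) \<le> real t * radial 1 lam (x t)"
      by (simp add: mult_left_mono)
    then show ?thesis
      using K(2)[of t] by simp
  qed
  have "norm (real t * \<gamma> t) \<le> 2 * K" if t: "real t > K" for t
  proof -
    have "t \<ge> 1"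
      using t K(1) by (cases t) auto
    let ?y = "x t - \<gamma> t *\<^sub>R h t"
    have step: "x (Suc t) = closest_point (cball 0 1) ?y"
      using sgd_step[OF \<open>t \<ge> 1\<close>] unfolding x_def h_def .
    have "real (Suc t) * norm (x (Suc t)) < real (Suc t) * 1"
      by (rule le_less_trans[OF xK]) (use t in simp)
    then have inside: "norm (x (Suc t)) < 1"
      by (simp only: mult_less_cancel_left_pos of_nat_0_less_iff zero_less_Suc)
    have "rel_interior (cball 0 1 :: 'a set) = ball 0 1" "affine hull (cball 0 1 :: 'a set) = UNIV"
      by (simp_all add: rel_interior_nonempty_interior affine_hull_nonempty_interior)
    then have "?y \<in> ball 0 1"
      using inside closest_point_in_rel_interior[of "cball 0 1" ?y] step by simp
    then have "?y \<in> cball 0 1"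
      using ball_subset_cball by blast
    then have "\<gamma> t *\<^sub>R h t = x t - x (Suc t)"
      using step by (simp add: closest_point_self)
    then have "norm (\<gamma> t *\<^sub>R h t) \<le> norm (x t) + norm (x (Suc t))"
      by (metis norm_triangle_ineq4)
    moreover have "\<bar>\<gamma> t\<bar> * 1 \<le> norm (\<gamma> t *\<^sub>R h t)"
      unfolding norm_scaleR h_def using norm_radial_subgradient_ge[of 1 lam e] lam e by (intro mult_left_mono) auto
    ultimately have "real t * \<bar>\<gamma> t\<bar> \<le> real t * (norm (x t) + norm (x (Suc t)))"
      by (simp add: mult_left_mono)
    also have "\<dots> \<le> real t * norm (x t) + real (Suc t) * norm (x (Suc t))"
      by (simp add: algebra_simps)
    also have "\<dots> \<le> 2 * K"
      using xK[of t] xK[of "Suc t"] by simp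
    finally show ?thesis
      by (simp add: abs_mult)
  qed
  moreover have "eventually (\<lambda>t. real t > K) sequentially"
    by (rule filterlim_at_top_dense[THEN iffD1, rule_format, OF filterlim_real_sequentially])
  ultimately show ?thesis
    by (intro BfunI[of _ "2 * K"]) (auto elim: eventually_mono)
qed

text \<open>
  This makes \<open>t * norm (x t) ^ 4\<close> nondecreasing along the trajectory of the quadratic
  objective, with \<open>a = lam * \<gamma> t\<close>. A fourth power says that \<open>norm (x t)\<close> decays no
  faster than \<open>t\<close> to the power \<open>-1/4\<close>; a square would only keep \<open>t\<close> times the
  error bounded away from 0.
\<close>

lemma contraction_keeps_fourth_power:
  fixes t a :: real
  assumes "t \<ge> 1" "0 \<le> a" "8 * t * a \<le> 1"
  shows "(t + 1) * (1 - a) ^ 4 \<ge> t"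
proof -
  have "8 * a \<le> 8 * t * a"
    using assms mult_right_mono[of 1 t a] by simp
  then have "a \<le> 1 / 8"
    using assms by linarith
  then have "1 - 4 * a \<le> (1 - a) ^ 4"
    using Bernoulli_inequality[of "- a" 4] by simp
  then have "(t + 1) * (1 - 4 * a) \<le> (t + 1) * (1 - a) ^ 4"
    using assms by (intro mult_left_mono) auto
  moreover have "(t + 1) * (1 - 4 * a) = t + 1 - 4 * t * a - 4 * a"
    by (simp add: algebra_simps)
  ultimately show ?thesis
    using assms \<open>a \<le> 1 / 8\<close> by linarith
qed

lemma bounded_steps_imp_quadratic_unbounded:
  fixes e :: "'a::euclidean_space"
  assumes e: "norm e = 1" and lam: "lam > 0"
    and steps: "\<And>t. t \<ge> 1 \<Longrightarrow> 0 \<le> \<gamma> t" "\<And>t. t \<ge> 1 \<Longrightarrow> 8 * lam * (real t * \<gamma> t) \<le> 1"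
  shows "\<not> Bseq (\<lambda>t. real t * radial 0 lam (sgd (cball 0 1) \<gamma> (\<lambda>_ _. radial_subgradient 0 lam e) e t \<omega>))"
proof
  define x where "x = (\<lambda>t. sgd (cball 0 1) \<gamma> (\<lambda>_ _. radial_subgradient 0 lam e) e t \<omega>)"
  have in_ball: "norm (x t) \<le> 1" for t
    using sgd_in_domain[of "cball 0 1" e] e unfolding x_def by auto
  have slow: "real t * norm (x t) ^ 4 \<ge> 1" if "t \<ge> 1" for t
    using that
  proof (induction t rule: dec_induct)
    case base
    then show ?case
      using e by (simp add: x_def)
  next
    case (step t)
    define a where "a = lam * \<gamma> t"
    have a: "0 \<le> a" "8 * real t * a \<le> 1"
      using steps[OF step(1)] lam by (auto simp: a_def algebra_simps)
    have "1 * a \<le> real t * a"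
      using a step(1) by (intro mult_right_mono) auto
    then have "a \<le> 1"
      using a by linarith
    then have "norm ((1 - a) *\<^sub>R x t) \<le> 1"
      using in_ball[of t] a mult_mono[of "1 - a" 1 "norm (x t)" 1] by simp
    moreover have "x (Suc t) = closest_point (cball 0 1) ((1 - a) *\<^sub>R x t)"
      unfolding x_def a_def sgd_step[OF step(1)] by (simp add: radial_subgradient_def algebra_simps)
    ultimately have "x (Suc t) = (1 - a) *\<^sub>R x t"
      by (simp add: closest_point_self)
    then have "real (Suc t) * norm (x (Suc t)) ^ 4 = ((real t + 1) * (1 - a) ^ 4) * norm (x t) ^ 4"
      using \<open>a \<le> 1\<close> by (simp add: power_mult_distrib)
    also have "\<dots> \<ge> real t * norm (x t) ^ 4"
      using contraction_keeps_fourth_power[of "real t" a] a step(1) by (intro mult_right_mono) auto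
    finally show ?case
      using step by linarith
  qed
  assume "Bseq (\<lambda>t. real t * radial 0 lam (sgd (cball 0 1) \<gamma> (\<lambda>_ _. radial_subgradient 0 lam e) e t \<omega>))"
  then obtain K where K: "\<And>t. norm (real t * radial 0 lam (x t)) \<le> K"
    unfolding x_def Bseq_def by blast
  have "real t \<le> (2 * K / lam)\<^sup>2" if "t \<ge> 1" for t
  proof -
    have "real t * (norm (x t))\<^sup>2 \<le> 2 * K / lam"
      using K[of t] lam by (simp add: radial_def field_simps)
    then have "(real t * (norm (x t))\<^sup>2)\<^sup>2 \<le> (2 * K / lam)\<^sup>2"
      by (intro power_mono) auto
    moreover have "real t * 1 \<le> real t * (real t * norm (x t) ^ 4)"
      using slow[OF that] by (intro mult_left_mono) auto
    moreover have "real t * (real t * norm (x t) ^ 4) = (real t * (norm (x t))\<^sup>2)\<^sup>2"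
      by (simp add: power_mult_distrib power2_eq_square power4_eq_xxxx)
    ultimately show ?thesis
      by simp
  qed
  moreover obtain t where "real t > max 1 ((2 * K / lam)\<^sup>2)"
    using reals_Archimedean2 by blast
  ultimately show False
    by (metis less_eq_real_def max_less_iff_conj not_le of_nat_1 of_nat_le_iff)
qed

theorem theorem5:
  fixes \<gamma> :: "nat \<Rightarrow> real"
  assumes "\<And>t. t \<ge> 1 \<Longrightarrow> \<gamma> t > 0"
  shows "bad_in_expectation TYPE('a::euclidean_space) \<gamma> \<or> bad_almost_surely TYPE('a) \<gamma>"
proof -
  obtain e :: 'a where e: "norm e = 1"
    using norm_Basis SOME_Basis by blast
  have bad: "bad_in_expectation TYPE('a) \<gamma>"
    if "c \<ge> 0" "lam > 0"
      and "\<not> Bseq (\<lambda>t. real t * radial c lam (sgd (cball 0 1) \<gamma> (\<lambda>_ _. radial_subgradient c lam e) e t (\<lambda>_::nat. 0::real)))"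
    for c lam
    by (rule bad_in_expectation_if_unbounded[OF admissible_radial])
      (use that e in \<open>auto simp: radial_def[of _ _ "0 :: 'a"]\<close>)
  have "bad_in_expectation TYPE('a) \<gamma>"
  proof (cases "Bseq (\<lambda>t. real t * \<gamma> t)")
    case False
    then show ?thesis
      using bounded_error_imp_steps_bounded[of 1 e e \<gamma> "\<lambda>_::nat. 0::real"] e by (intro bad[of 1 1]) auto
  next
    case True
    then obtain C where C: "C > 0" "\<And>t. norm (real t * \<gamma> t) \<le> C"
      by (auto elim: BseqE)
    have "8 * (1 / (8 * C)) * (real t * \<gamma> t) \<le> 1" for t
      using C(1) C(2)[of t] by (simp add: field_simps)
    then show ?thesis
      using C(1) assms e
      by (intro bad[of 0 "1 / (8 * C)"] bounded_steps_imp_quadratic_unbounded) (auto simp: less_imp_le)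
  qed
  then show ?thesis
    by blast
qed

end
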